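(* Let $r,\ell$ be positive integers. For every coloring $c:\mathbf{N}\to\{0,\dots,r-1\}$ there exist an infinite apart set $X$ of positive integers and positive integers $a,b$ such that all elements of $FS^{\{a,\,a+b,\,a+2b,\dots,a+(\ell-1)b\}\cup\{b\}}(X)$ have the same color under $c$.
   Context: $\mathbf{N}$ is the set of natural numbers. For a positive integer $n=2^{t_1}+\dots+2^{t_k}$ with $t_1<\dots<t_k$ let $\lambda(n)=t_1$ and $\mu(n)=t_k$. A set $X$ of positive integers is apart (satisfies the Apartness Condition) if for all $x,x'\in X$ with $x<x'$ we have $\mu(x)<\lambda(x')$. For a set $A$ of positive integers and a set $B\subseteq\mathbf{N}$, $FS^{A}(B)$ denotes the set of all sums of exactly $j$ distinct elements of $B$, for all $j\in A$. *)

theory Defs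
  imports Main "HOL-Library.Nat_Bijection"
begin

text \<open>
  The library function \<^const>\<open>set_decode\<close> maps a natural number to the set of exponents
  occurring in its binary expansion.
\<close>

lemma binary_expansion: "n = (\<Sum>t\<in>set_decode n. 2 ^ t)"
  using set_decode_inverse[of n] by (simp add: set_encode_def)

text \<open>Both functions below are meaningful only for positive arguments.\<close>

definition least_exp :: "nat \<Rightarrow> nat"  (* the paper's lambda *)
  where "least_exp n = Min (set_decode n)"

definition greatest_exp :: "nat \<Rightarrow> nat"  (* the paper's mu *)
  where "greatest_exp n = Max (set_decode n)"

definition apart :: "nat set \<Rightarrow> bool"
  where "apart X \<longleftrightarrow>
    (\<forall>x\<in>X. x > 0) \<and> (\<forall>x\<in>X. \<forall>y\<in>X. x < y \<longrightarrow> greatest_exp x < least_exp y)"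

definition FS :: "nat set \<Rightarrow> nat set \<Rightarrow> nat set"
  where "FS A B = {\<Sum>F | F. F \<subseteq> B \<and> finite F \<and> card F \<in> A}"

end

theory Submission
  imports Defs "HOL-Library.Ramsey"
begin

text \<open>
  By Ramsey's theorem, applied once for each size \<open>j \<le> M\<close>, some infinite set of powers of two has
  the property that the colour of a sum of \<open>j\<close> distinct elements depends only on \<open>j\<close>. Brauer's
  theorem (van der Waerden's theorem with the common difference in the same colour class), applied
  to this colouring of \<open>{1..M}\<close>, yields \<open>a\<close> and \<open>b\<close>. Van der Waerden's theorem is proved by
  colour focusing, and Brauer's theorem follows from it by induction on the number of colours.
\<close>

section \<open>Van der Waerden's theorem\<close>

text \<open>Progressions have \<open>k + 1\<close> terms. For \<open>k = 0\<close> the condition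
  \<open>a + k * d < N\<close> leaves \<open>d\<close> unbounded, so \<open>d \<le> N\<close> is
  demanded separately; the focusing step moves back by \<open>d\<close> and relies on it.\<close>

definition has_ap :: "nat \<Rightarrow> nat \<Rightarrow> (nat \<Rightarrow> 'a) \<Rightarrow> bool"
  where "has_ap k N c \<longleftrightarrow>
    (\<exists>a d. 0 < d \<and> d \<le> N \<and> a + k * d < N \<and> (\<forall>i\<le>k. c (a + i * d) = c a))"

text \<open>The palette \<open>C\<close> is any finite set of at most \<open>r\<close> naturals, so
  that codes of blocks serve as colours without renumbering.\<close>

definition vdw :: "nat \<Rightarrow> nat \<Rightarrow> nat \<Rightarrow> bool"
  where "vdw k r N \<longleftrightarrow>
    (\<forall>(c :: nat \<Rightarrow> nat) C. finite C \<and> card C \<le> r \<and> c ` {..<N} \<subseteq> C \<longrightarrow> has_ap k N c)"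

text \<open>
  The colours in \<open>K\<close> are those of monochromatic progressions \<open>f + d, \<dots>, f + k d\<close>, which would all
  be extended by the common focus \<open>f\<close>.
\<close>

definition focused :: "nat \<Rightarrow> nat \<Rightarrow> (nat \<Rightarrow> 'a) \<Rightarrow> nat \<Rightarrow> 'a set \<Rightarrow> bool"
  where "focused k N c f K \<longleftrightarrow> f < N \<and>
    (\<forall>t\<in>K. \<exists>d>0. f + k * d < N \<and> (\<forall>i\<in>{1..k}. c (f + i * d) = t))"

lemma has_ap_shift:
  assumes "has_ap k N (\<lambda>x. c (p + x))" and "p + N \<le> N'"
  shows "has_ap k N' c"
proof -
  obtain a d where "0 < d" "d \<le> N" "a + k * d < N" "\<forall>i\<le>k. c (p + (a + i * d)) = c (p + a)"
    using assms(1) unfolding has_ap_def by blast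
  with assms(2) show ?thesis
    unfolding has_ap_def
    by (intro exI[of _ "p + a"] exI[of _ d]) (auto simp: add.assoc)
qed

text \<open>The progression in the colour of \<open>f\<close> is prolonged by \<open>f\<close>
  itself, as the term for \<open>i = 0\<close>.\<close>

lemma has_ap_if_focus_in:
  assumes "focused (Suc k) N c f K" and "c f \<in> K"
  shows "has_ap (Suc k) N c"
proof -
  obtain d where d: "d > 0" "f + Suc k * d < N" "\<forall>i\<in>{1..Suc k}. c (f + i * d) = c f"
    using assms unfolding focused_def by blast
  have "c (f + i * d) = c f" if "i \<le> Suc k" for i
    using d(3) that by (cases "i = 0") auto
  moreover have "d \<le> N"
    using d(2) by simp
  ultimately show ?thesis
    unfolding has_ap_def using d by blast
qed

text \<open>Each start \<open>x < M\<close> is coloured by the code of its window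
  \<open>c x, ..., c (x + N - 1)\<close>. There are at most \<open>r ^ N\<close> windows, and a
  monochromatic progression of starts makes \<open>c\<close> repeat on windows shifted by
  \<open>d\<close>.\<close>

lemma vdw_blocks:
  fixes c :: "nat \<Rightarrow> nat"
  assumes "vdw k (r ^ N) M" and "finite C" "card C \<le> r" and "c ` {..<M + N} \<subseteq> C"
  obtains a d where "0 < d" "d \<le> M" "a + k * d < M"
    "\<forall>i\<le>k. \<forall>y<N. c (a + i * d + y) = c (a + y)"
proof -
  define block where "block x = list_encode (map c [x..<x + N])" for x
  define L where "L = {xs. set xs \<subseteq> C \<and> length xs = N}"
  have "finite (list_encode ` L)"
    unfolding L_def using assms(2) by (simp add: finite_lists_length_eq)
  moreover have "card (list_encode ` L) \<le> r ^ N"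
  proof -
    have "card (list_encode ` L) \<le> card L"
      unfolding L_def using assms(2) by (intro card_image_le finite_lists_length_eq)
    also have "\<dots> \<le> r ^ N"
      unfolding L_def using assms(2,3) by (simp add: card_lists_length_eq power_mono)
    finally show ?thesis .
  qed
  moreover have "block ` {..<M} \<subseteq> list_encode ` L"
    using assms(4) unfolding block_def L_def by (auto simp: image_subset_iff)
  ultimately have "has_ap k M block"
    using assms(1) unfolding vdw_def by blast
  then obtain a d where ad: "0 < d" "d \<le> M" "a + k * d < M" "\<forall>i\<le>k. block (a + i * d) = block a"
    unfolding has_ap_def by blast
  have "c (a + i * d + y) = c (a + y)" if "i \<le> k" "y < N" for i y
  proof -
    have "map c [a + i * d..<a + i * d + N] = map c [a..<a + N]"
      using ad(4) that(1) unfolding block_def by (metis list_encode_eq)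
    then have "map c [a + i * d..<a + i * d + N] ! y = map c [a..<a + N] ! y"
      by simp
    with that(2) show ?thesis
      by simp
  qed
  with ad show thesis
    by (intro that) auto
qed

section \<open>Colour focusing\<close>

definition focusing :: "nat \<Rightarrow> nat \<Rightarrow> nat \<Rightarrow> nat \<Rightarrow> bool"
  where "focusing k r s N \<longleftrightarrow>
    (\<forall>(c :: nat \<Rightarrow> nat) C. finite C \<and> card C \<le> r \<and> c ` {..<N} \<subseteq> C \<longrightarrow>
      has_ap k N c \<or> (\<exists>f K. K \<subseteq> C \<and> card K = s \<and> focused k N c f K))"

text \<open>A window of length \<open>N\<close> with \<open>s\<close> focused colours recurs
  \<open>k + 1\<close> times with step \<open>d\<close>. Adding the step \<open>d\<close> between
  windows to a step \<open>e\<close> inside them gives rays with a new common focus, and the copies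
  of the old focus contribute one more colour.\<close>

lemma ex_focusing:
  assumes "\<And>r. \<exists>N. vdw k r N"
  shows "\<exists>N. focusing (Suc k) r s N"
proof (induction s)
  case 0
  have "focused (Suc k) 1 c 0 {}" for c :: "nat \<Rightarrow> nat"
    unfolding focused_def by simp
  then have "focusing (Suc k) r 0 1"
    unfolding focusing_def by (metis card.empty empty_subsetI)
  then show ?case ..
next
  case (Suc s)
  then obtain N where N: "focusing (Suc k) r s N" ..
  obtain M where M: "vdw k (r ^ N) M"
    using assms by blast
  have "has_ap (Suc k) (M + (M + N)) c \<or>
      (\<exists>f K. K \<subseteq> C \<and> card K = Suc s \<and> focused (Suc k) (M + (M + N)) c f K)"
    if C: "finite C" "card C \<le> r" and c: "c ` {..<M + (M + N)} \<subseteq> C" for c :: "nat \<Rightarrow> nat" and C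
  proof -
    text \<open>The offset \<open>M\<close> leaves room below the blocks for the new focus \<open>f - d\<close>.\<close>
    have "(\<lambda>x. c (M + x)) ` {..<M + N} \<subseteq> C"
      using c by auto
    from vdw_blocks[OF M C this] obtain a d where ad: "0 < d" "d \<le> M" "a + k * d < M"
      and eq: "\<forall>i\<le>k. \<forall>y<N. c (M + (a + i * d + y)) = c (M + (a + y))" .
    define p where "p = M + a"
    have p: "d \<le> p" "p + k * d < M + M"
      unfolding p_def using ad by auto
    have eq: "c (p + i * d + y) = c (p + y)" if "i \<le> k" "y < N" for i y
      using eq that unfolding p_def by (simp add: add.assoc)
    define c' where "c' = (\<lambda>x. c (p + x))"
    have bound: "p + N \<le> M + (M + N)"
      using p by simp
    have shift: "has_ap (Suc k) (M + (M + N)) c" if "has_ap (Suc k) N c'"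
      using has_ap_shift[OF that[unfolded c'_def] bound] .
    have "c' ` {..<N} \<subseteq> C"
      using c bound unfolding c'_def by (auto simp: image_subset_iff)
    with N C have "has_ap (Suc k) N c' \<or>
        (\<exists>f K. K \<subseteq> C \<and> card K = s \<and> focused (Suc k) N c' f K)"
      unfolding focusing_def by blast
    then consider "has_ap (Suc k) N c'"
      | f K where "K \<subseteq> C" "card K = s" "focused (Suc k) N c' f K" "c' f \<in> K"
      | f K where "K \<subseteq> C" "card K = s" "focused (Suc k) N c' f K" "c' f \<notin> K"
      by blast
    then show ?thesis
    proof cases
      case 1
      then show ?thesis
        using shift by blast
    next
      case 2
      show ?thesis
        using shift has_ap_if_focus_in[OF 2(3,4)] by blast
    next
      case 3
      have f: "f < N"
        using 3 unfolding focused_def by blast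
      \<comment> \<open>\<open>g\<close> lies one step \<open>d\<close> before the first copy of
        \<open>f\<close>. Hence \<open>g + Suc j * (d + e)\<close> is term \<open>Suc j\<close> of
        the old ray, read in window \<open>j\<close>.\<close>
      define g where "g = p - d + f"
      have ray: "\<exists>e>0. g + Suc k * e < M + (M + N) \<and> (\<forall>i\<in>{1..Suc k}. c (g + i * e) = t)"
        if "f + Suc k * e < N" "\<forall>i\<in>{1..Suc k}. c' (f + i * e) = t" for e t
      proof (intro exI[of _ "d + e"] conjI ballI)
        have shift_ray: "g + Suc j * (d + e) = p + j * d + (f + Suc j * e)" for j
          unfolding g_def using p(1) by (simp add: algebra_simps)
        show "g + Suc k * (d + e) < M + (M + N)"
          unfolding shift_ray using that(1) p(2) by linarith
        fix i assume i: "i \<in> {1..Suc k}"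
        then obtain j where j: "i = Suc j" "j \<le> k"
          by (cases i) auto
        have "f + i * e < N"
          using that(1) i by (meson add_left_mono atLeastAtMost_iff le_less_trans mult_le_mono1)
        then have "c (g + i * (d + e)) = c' (f + i * e)"
          unfolding j(1) shift_ray c'_def using eq j(2) by simp
        then show "c (g + i * (d + e)) = t"
          using that(2) i by simp
      qed (use ad in simp)
      have "focused (Suc k) (M + (M + N)) c g (insert (c' f) K)"
        unfolding focused_def
      proof (intro conjI ballI)
        show "g < M + (M + N)"
          unfolding g_def using p f by linarith
        fix t assume "t \<in> insert (c' f) K"
        then consider "t = c' f" | "t \<in> K"
          by blast
        then show "\<exists>e>0. g + Suc k * e < M + (M + N) \<and> (\<forall>i\<in>{1..Suc k}. c (g + i * e) = t)"
        proof cases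
          \<comment> \<open>With \<open>e = 0\<close> the ray consists of the \<open>k + 1\<close>
            copies of \<open>f\<close>; its colour is new because
            \<open>c' f \<notin> K\<close>.\<close>
          case 1
          then show ?thesis
            using ray[of 0 t] f by simp
        next
          case 2
          then show ?thesis
            using 3(3) ray unfolding focused_def by blast
        qed
      qed
      moreover have "insert (c' f) K \<subseteq> C"
        using 3(1) f \<open>c' ` {..<N} \<subseteq> C\<close> by auto
      moreover have "card (insert (c' f) K) = Suc s"
        using 3 C(1) finite_subset by (metis card_insert_disjoint)
      ultimately show ?thesis
        by blast
    qed
  qed
  then have "focusing (Suc k) r (Suc s) (M + (M + N))"
    unfolding focusing_def by blast
  then show ?case ..
qed

theorem van_der_Waerden: "\<exists>N. vdw k r N"
proof (induction k arbitrary: r)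
  case 0
  have "vdw 0 r 1"
    unfolding vdw_def has_ap_def by auto
  then show ?case ..
next
  case (Suc k)
  from ex_focusing[OF this] obtain N where N: "focusing (Suc k) r (Suc r) N" ..
  \<comment> \<open>With at most \<open>r\<close> colours, \<open>Suc r\<close> of them cannot be
    focused, so only the progression remains.\<close>
  have "\<not> (K \<subseteq> C \<and> card K = Suc r)" if "finite C" "card C \<le> r" for K C :: "nat set"
    using that card_mono[of C K] by auto
  with N have "vdw (Suc k) r N"
    unfolding vdw_def focusing_def by blast
  then show ?case ..
qed

section \<open>Brauer's theorem\<close>

definition brauer :: "nat \<Rightarrow> nat \<Rightarrow> nat \<Rightarrow> bool"
  where "brauer l r M \<longleftrightarrow>
    (\<forall>(c :: nat \<Rightarrow> nat) C. finite C \<and> card C \<le> r \<and> c ` {1..M} \<subseteq> C \<longrightarrow>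
      (\<exists>a b. 0 < a \<and> 0 < b \<and> b \<le> M \<and> a + l * b \<le> M \<and> (\<forall>i\<le>l. c (a + i * b) = c b)))"

text \<open>Take a long monochromatic progression with step \<open>d\<close>. If some
  \<open>j * d\<close> with \<open>1 \<le> j \<le> M\<close> has its colour, a subprogression with
  difference \<open>j * d\<close> works. Otherwise \<open>d, 2 d, ..., M d\<close> avoid that
  colour, and the induction hypothesis applies to them after division by \<open>d\<close>.\<close>

theorem Brauer: "\<exists>M. brauer l r M"
proof (induction r)
  case 0
  \<comment> \<open>Vacuous: the nonempty interval \<open>{1..1}\<close> has no colouring by an
    empty palette.\<close>
  have "brauer l 0 1"
    unfolding brauer_def by auto
  then show ?case ..
next
  case (Suc r)
  then obtain M where M: "brauer l r M" ..
  \<comment> \<open>The terms with index \<open>i * j\<close>, for \<open>i \<le> l\<close> and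
    \<open>j \<le> M\<close>, must all lie in the progression.\<close>
  obtain N where N: "vdw (Suc l * M) (Suc r) N"
    using van_der_Waerden ..
  \<comment> \<open>\<open>N\<close> covers the progression, moved up by one because positions now
    start at 1; \<open>M * N\<close> covers the multiples \<open>j * d\<close> with
    \<open>j \<le> M\<close>.\<close>
  define N' where "N' = N + M * N"
  have "\<exists>a b. 0 < a \<and> 0 < b \<and> b \<le> N' \<and> a + l * b \<le> N' \<and> (\<forall>i\<le>l. c (a + i * b) = c b)"
    if C: "finite C" "card C \<le> Suc r" and c: "c ` {1..N'} \<subseteq> C" for c :: "nat \<Rightarrow> nat" and C
  proof -
    have "(\<lambda>x. c (Suc x)) ` {..<N} \<subseteq> C"
      using c unfolding N'_def by (auto simp: image_subset_iff)
    then have "has_ap (Suc l * M) N (\<lambda>x. c (Suc x))"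
      using N C unfolding vdw_def by blast
    then obtain a d where d: "0 < d" "d \<le> N" "a + Suc l * M * d < N"
      and mono: "\<And>i. i \<le> Suc l * M \<Longrightarrow> c (Suc (a + i * d)) = c (Suc a)"
      unfolding has_ap_def by blast
    have small: "j * d \<le> N'" if "j \<le> M" for j
      unfolding N'_def using that d(2) by (meson mult_le_mono trans_le_add2)
    show ?thesis
    proof (cases "\<exists>j\<in>{1..M}. c (j * d) = c (Suc a)")
      case True
      then obtain j where j: "1 \<le> j" "j \<le> M" "c (j * d) = c (Suc a)"
        by auto
      have le: "i * j \<le> Suc l * M" if "i \<le> l" for i
        using that j(2) by (intro mult_le_mono) auto
      have "Suc a + l * (j * d) \<le> N'"
      proof -
        have "l * (j * d) \<le> Suc l * M * d"
          using le[of l] by (metis mult.assoc mult_le_mono1 order_refl)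
        then show ?thesis
          unfolding N'_def using d(3) by linarith
      qed
      moreover have "c (Suc a + i * (j * d)) = c (j * d)" if "i \<le> l" for i
        using mono[OF le[OF that]] j(3) by (simp add: mult.assoc)
      ultimately show ?thesis
        using small[OF j(2)] j(1) d(1)
        by (intro exI[of _ "Suc a"] exI[of _ "j * d"]) auto
    next
      case False
      have "c (Suc a) \<in> C"
        using c d(3) unfolding N'_def by (auto simp: image_subset_iff)
      then have "card (C - {c (Suc a)}) \<le> r"
        using C by simp
      moreover have "(\<lambda>j. c (j * d)) ` {1..M} \<subseteq> C - {c (Suc a)}"
        using False c small d(1) by (auto simp: image_subset_iff Suc_le_eq)
      ultimately obtain a' b where ab: "0 < a'" "0 < b" "b \<le> M" "a' + l * b \<le> M"
        "\<forall>i\<le>l. c ((a' + i * b) * d) = c (b * d)"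
        using M C(1) unfolding brauer_def by (meson finite_Diff)
      have "a' * d + i * (b * d) = (a' + i * b) * d" for i
        by (simp add: algebra_simps)
      then show ?thesis
        using ab d(1) small[OF ab(3)] small[OF ab(4)]
        by (intro exI[of _ "a' * d"] exI[of _ "b * d"]) auto
    qed
  qed
  then have "brauer l (Suc r) N'"
    unfolding brauer_def by blast
  then show ?case ..
qed

section \<open>Homogeneous sets of powers of two\<close>

lemma set_decode_power_2: "set_decode (2 ^ t) = {t}"
proof -
  have "set_decode (set_encode {t}) = {t}"
    by (intro set_encode_inverse) simp
  then show ?thesis
    by (simp add: set_encode_def)
qed

text \<open>A power of two has a single exponent, so apartness reduces to the order of exponents and
  survives any thinning by Ramsey's theorem.\<close>

lemma apart_powers_of_2:
  assumes "X \<subseteq> range (\<lambda>t. 2 ^ t)"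
  shows "apart X"
  unfolding apart_def
proof (intro conjI ballI impI)
  fix x assume "x \<in> X"
  with assms obtain s where s: "x = 2 ^ s"
    by blast
  then show "x > 0"
    by simp
  fix y assume "y \<in> X" "x < y"
  with assms obtain t where t: "y = 2 ^ t"
    by blast
  with s \<open>x < y\<close> have "s < t"
    by simp
  then show "greatest_exp x < least_exp y"
    unfolding s t greatest_exp_def least_exp_def by (simp add: set_decode_power_2)
qed

definition size_homogeneous :: "('a set \<Rightarrow> 'b) \<Rightarrow> nat \<Rightarrow> 'a set \<Rightarrow> (nat \<Rightarrow> 'b) \<Rightarrow> bool"
  where "size_homogeneous f M Y d \<longleftrightarrow>
    (\<forall>F. F \<subseteq> Y \<and> finite F \<and> card F \<le> M \<longrightarrow> f F = d (card F))"

text \<open>Homogeneity for sizes up to \<open>M\<close> passes to subsets, so Ramsey's theorem for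
  size \<open>Suc M\<close> can be applied inside the set already found.\<close>

lemma Ramsey_upto:
  fixes Z :: "nat set" and f :: "nat set \<Rightarrow> nat"
  assumes "infinite Z" and "\<And>F. f F < r"
  shows "\<exists>Y d. Y \<subseteq> Z \<and> infinite Y \<and> (\<forall>j. d j < r) \<and> size_homogeneous f M Y d"
proof (induction M)
  case 0
  show ?case
    \<comment> \<open>Only the empty set counts here; a constant \<open>d\<close> keeps all values
      below \<open>r\<close>.\<close>
    by (intro exI[of _ Z] exI[of _ "\<lambda>_. f {}"]) (use assms in \<open>auto simp: size_homogeneous_def\<close>)
next
  case (Suc M)
  then obtain Y d where Y: "Y \<subseteq> Z" "infinite Y" "\<forall>j. d j < r" "size_homogeneous f M Y d"
    by blast
  have "\<exists>Y' t. Y' \<subseteq> Y \<and> infinite Y' \<and> t < r \<and>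
      (\<forall>F. F \<subseteq> Y' \<and> finite F \<and> card F = Suc M \<longrightarrow> f F = t)"
    by (rule Ramsey) (use Y(2) assms(2) in auto)
  then obtain Y' t where Y': "Y' \<subseteq> Y" "infinite Y'" "t < r"
    "\<forall>F. F \<subseteq> Y' \<and> finite F \<and> card F = Suc M \<longrightarrow> f F = t"
    by blast
  have "f F = (d(Suc M := t)) (card F)" if F: "F \<subseteq> Y'" "finite F" "card F \<le> Suc M" for F
  proof (cases "card F = Suc M")
    case True
    then show ?thesis
      using F Y'(4) by simp
  next
    case False
    then show ?thesis
      using F Y(4) Y'(1) unfolding size_homogeneous_def by auto
  qed
  then have "size_homogeneous f (Suc M) Y' (d(Suc M := t))"
    unfolding size_homogeneous_def by blast
  moreover have "\<forall>j. (d(Suc M := t)) j < r"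
    using Y(3) Y'(3) by simp
  ultimately show ?case
    using Y(1) Y'(1,2) by blast
qed

theorem mainTheorem8:
  fixes r l :: nat and c :: "nat \<Rightarrow> nat"
  assumes "r > 0" and "l > 0"
    and "\<forall>n. c n \<in> {0..<r}"
  shows "\<exists>(X :: nat set) (a :: nat) (b :: nat).
    infinite X \<and> apart X \<and> a > 0 \<and> b > 0 \<and>
    (\<forall>x \<in> FS ({a + i * b | i. i < l} \<union> {b}) X.
     \<forall>y \<in> FS ({a + i * b | i. i < l} \<union> {b}) X. c x = c y)"
proof -
  \<comment> \<open>\<open>M\<close> is fixed first, since the thinning handles only sizes up to a
    given bound.\<close>
  obtain M where M: "brauer l r M"
    using Brauer ..
  have "infinite (range (\<lambda>t. 2 ^ t :: nat))"
    by (intro range_inj_infinite injI) simp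
  then obtain X d where X: "X \<subseteq> range (\<lambda>t. 2 ^ t)" "infinite X" "\<forall>j. d j < r"
    and hom: "size_homogeneous (\<lambda>F. c (\<Sum>F)) M X d"
    using Ramsey_upto[of "range (\<lambda>t. 2 ^ t)" "\<lambda>F. c (\<Sum>F)" r M] assms(3) by auto
  have "finite {..<r} \<and> card {..<r} \<le> r \<and> d ` {1..M} \<subseteq> {..<r}"
    using X(3) by auto
  from M[unfolded brauer_def, rule_format, OF this]
  obtain a b where ab: "0 < a" "0 < b" "b \<le> M" "a + l * b \<le> M"
    and mono: "\<forall>i\<le>l. d (a + i * b) = d b"
    by blast
  \<comment> \<open>Brauer's theorem was applied to \<open>d\<close>, a colouring of sizes. Each
    size in question is thus within the homogeneous range, and \<open>b\<close> itself, as a size,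
    has the colour of the progression.\<close>
  have size: "j \<le> M \<and> d j = d b" if "j \<in> {a + i * b | i. i < l} \<union> {b}" for j
  proof -
    have "a + i * b \<le> M" if "i < l" for i
      using that ab(4) by (meson add_left_mono le_trans less_imp_le mult_le_mono1)
    with that ab mono show ?thesis
      by auto
  qed
  have colour: "c x = d b" if x: "x \<in> FS ({a + i * b | i. i < l} \<union> {b}) X" for x
  proof -
    obtain F where F: "x = \<Sum>F" "F \<subseteq> X" "finite F" "card F \<in> {a + i * b | i. i < l} \<union> {b}"
      using x unfolding FS_def by blast
    then have "c (\<Sum>F) = d (card F)"
      using hom size[OF F(4)] unfolding size_homogeneous_def by blast
    then show ?thesis
      using F(1) size[OF F(4)] by simp
  qed
  show ?thesis
  proof (intro exI conjI ballI)
    show "infinite X" "apart X" "a > 0" "b > 0"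
      using X ab apart_powers_of_2 by simp_all
    fix x y
    assume "x \<in> FS ({a + i * b | i. i < l} \<union> {b}) X" "y \<in> FS ({a + i * b | i. i < l} \<union> {b}) X"
    then show "c x = c y"
      by (simp only: colour)
  qed
qed

end
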